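(* Let $n$ be a positive integer or half-integer (i.e. $2n$ is a positive integer). Let $G$ be an arbitrary (simple) graph, and let $E_1, \ldots, E_{2n}$ be (not necessarily distinct) sets of edges of $G$ such that $\nu^*(E_i) \ge n$ for every $i = 1, \ldots, 2n$. Then the family $E_1,\ldots,E_{2n}$ has a rainbow fractional matching of size $n$.
   Context: For a set $E$ of edges (each edge a subset of a vertex set), a fractional matching for $E$ is a function $f\colon E \to \mathbb{R}_{\ge 0}$ such that $\sum_{e \in E,\, e \ni v} f(e) \le 1$ for every vertex $v$; its size is $\sum_{e\in E} f(e)$. The fractional matching number $\nu^*(E)$ is the maximum size of a fractional matching for $E$. Given a family $E_1,\ldots,E_m$ of sets of edges, a rainbow fractional matching of size $n$ is a set of edges $\{e_1,\ldots,e_k\}$ with $e_j \in E_{\sigma(j)}$ for $j=1,\ldots,k$, where $\sigma(1),\ldots,\sigma(k)$ are distinct indices, together with a fractional matching $f\colon\{e_1,\ldots,e_k\}\to\mathbb{R}_{\ge 0}$ of size $n$. *)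

theory Defs
  imports "HOL-Analysis.Analysis"
begin

definition simple_graph :: "'a set \<Rightarrow> 'a set set \<Rightarrow> bool" where
  "simple_graph V D \<longleftrightarrow> (\<forall>e\<in>D. e \<subseteq> V \<and> card e = 2)"

(* Edge sets may be infinite, so sums of weights are taken in ennreal, where every
   unordered sum exists. (A real-valued infsum would be 0 for a divergent sum.) *)

definition matching_size :: "'a set set \<Rightarrow> ('a set \<Rightarrow> real) \<Rightarrow> ennreal" where
  "matching_size E f = (\<Sum>\<^sub>\<infinity>e\<in>E. ennreal (f e))"

(* Only the values of f on E matter. A vertex v lying on no edge of E imposes no
   constraint, so v may range over the whole type. *)

definition fractional_matching :: "'a set set \<Rightarrow> ('a set \<Rightarrow> real) \<Rightarrow> bool" where
  "fractional_matching E f \<longleftrightarrow>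
     (\<forall>e\<in>E. 0 \<le> f e) \<and> (\<forall>v. (\<Sum>\<^sub>\<infinity>e\<in>{e \<in> E. v \<in> e}. ennreal (f e)) \<le> 1)"

(* For finite E the supremum is a maximum. *)

definition fractional_matching_number :: "'a set set \<Rightarrow> ennreal" where
  "fractional_matching_number E = Sup {matching_size E f | f. fractional_matching E f}"

(* The number n is meant to be nonnegative, since ennreal truncates negative reals to 0. *)

definition has_rainbow_fractional_matching ::
    "nat \<Rightarrow> (nat \<Rightarrow> 'a set set) \<Rightarrow> real \<Rightarrow> bool" where
  "has_rainbow_fractional_matching m E n \<longleftrightarrow>
     (\<exists>(k::nat) (e :: nat \<Rightarrow> 'a set) (\<sigma> :: nat \<Rightarrow> nat) (f :: 'a set \<Rightarrow> real).
        inj_on \<sigma> {1..k} \<and>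
        (\<forall>j\<in>{1..k}. \<sigma> j \<in> {1..m} \<and> e j \<in> E (\<sigma> j)) \<and>
        fractional_matching (e ` {1..k}) f \<and>
        matching_size (e ` {1..k}) f = ennreal n)"

lemma matching_size_finite:
  assumes "finite E" "\<And>e. e \<in> E \<Longrightarrow> 0 \<le> f e"
  shows "matching_size E f = ennreal (\<Sum>e\<in>E. f e)"
  using assms by (simp add: matching_size_def sum_ennreal)

lemma fractional_matching_finite:
  assumes "finite E"
  shows "fractional_matching E f \<longleftrightarrow>
     (\<forall>e\<in>E. 0 \<le> f e) \<and> (\<forall>v. (\<Sum>e\<in>{e \<in> E. v \<in> e}. f e) \<le> 1)"
proof (cases "\<forall>e\<in>E. 0 \<le> f e")
  case True
  then have "(\<Sum>\<^sub>\<infinity>e\<in>{e \<in> E. v \<in> e}. ennreal (f e)) = ennreal (\<Sum>e\<in>{e \<in> E. v \<in> e}. f e)" for v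
    using assms True by (auto intro!: sum_ennreal)
  then show ?thesis
    using True by (simp add: fractional_matching_def)
next
  case False
  then show ?thesis
    unfolding fractional_matching_def by blast
qed

end

theory Submission
  imports Defs
begin

text \<open>
  For small \<open>c > 0\<close>, choose edges \<open>e j\<close> from finite subsets of the \<open>E j\<close> and weights
  \<open>a j \<ge> 0\<close> minimizing the sum of the \<open>x v\<^sup>2\<close> minus \<open>c\<close> times the total weight, where
  \<open>x v\<close> is the amount by which the load of the vertex \<open>v\<close> exceeds 1. First-order
  optimality says that the \<open>x v\<close> of the two ends of a chosen edge sum to at least \<open>c / 2\<close>,
  with equality if the edge carries weight. Among the minimizers there is one whose support is
  no larger than the number of vertices of load at least 1, hence at most twice the total weight.
  If the total weight is below \<open>n\<close>, then some index \<open>i\<close> carries no weight, so \<open>e i\<close> can be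
  exchanged for any other edge of the \<open>i\<close>-th set; thus \<open>2 x / c\<close> is a fractional cover of
  this whole set, and weak duality bounds the total weight from below by the size of any fractional
  matching of the set. All loads are at most \<open>1 + c / 2\<close>, so rescaling gives rainbow fractional
  matchings of size arbitrarily close to \<open>n\<close>. The attainable sizes have a gap below \<open>n\<close>, because
  a family of \<open>m\<close> edges has only finitely many incidence patterns.
\<close>

section \<open>Underdetermined homogeneous linear systems\<close>

text \<open>Gaussian elimination, one equation per induction step: an equation with zero
  coefficients is dropped, otherwise a pivot unknown \<open>p\<close> is eliminated from the
  remaining ones.\<close>

lemma homogeneous_system_nontrivial_solution:
  fixes A :: "'j \<Rightarrow> 'v \<Rightarrow> 'k::field"
  assumes "finite T" "finite B" "card T < card B"
  shows "\<exists>h. (\<exists>j\<in>B. h j \<noteq> 0) \<and> (\<forall>v\<in>T. (\<Sum>j\<in>B. A j v * h j) = 0)"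
  using assms
proof (induction T arbitrary: B A rule: finite_induct)
  case empty
  then obtain j where "j \<in> B" by (metis card_gt_0_iff card.empty ex_in_conv)
  then show ?case by (intro exI[of _ "\<lambda>_. 1"]) auto
next
  case (insert v T)
  show ?case
  proof (cases "\<forall>j\<in>B. A j v = 0")
    case True
    obtain h where "\<exists>j\<in>B. h j \<noteq> 0" "\<forall>u\<in>T. (\<Sum>j\<in>B. A j u * h j) = 0"
      using insert.IH[of B A] insert.prems insert.hyps by auto
    then show ?thesis using True by (intro exI[of _ h]) auto
  next
    case False
    then obtain p where p: "p \<in> B" "A p v \<noteq> 0" by blast
    define A' where "A' = (\<lambda>j u. A j u - A j v / A p v * A p u)"
    have "card T < card (B - {p})"
      using insert.prems insert.hyps p by auto
    then obtain h where h: "\<exists>j\<in>B - {p}. h j \<noteq> 0"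
      "\<forall>u\<in>T. (\<Sum>j\<in>B - {p}. A' j u * h j) = 0"
      using insert.IH[of "B - {p}" A'] insert.prems by auto
    define g where "g = h(p := - (\<Sum>j\<in>B - {p}. A j v * h j) / A p v)"
    have g: "(\<Sum>j\<in>B. A j u * g j) = (\<Sum>j\<in>B - {p}. A' j u * h j)" for u
    proof -
      have "(\<Sum>j\<in>B. A j u * g j) = A p u * g p + (\<Sum>j\<in>B - {p}. A j u * g j)"
        using p insert.prems by (simp add: sum.remove)
      also have "(\<Sum>j\<in>B - {p}. A j u * g j) = (\<Sum>j\<in>B - {p}. A j u * h j)"
        by (intro sum.cong) (auto simp: g_def)
      also have "A p u * g p = - (\<Sum>j\<in>B - {p}. A j v / A p v * A p u * h j)"
        by (simp add: g_def sum_divide_distrib sum_distrib_left mult_ac)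
      finally show ?thesis
        by (simp add: A'_def left_diff_distrib sum_subtractf)
    qed
    have "A' j v = 0" for j using p by (simp add: A'_def)
    then have "\<forall>u\<in>insert v T. (\<Sum>j\<in>B. A j u * g j) = 0"
      using h(2) by (simp add: g)
    moreover have "\<exists>j\<in>B. g j \<noteq> 0" using h(1) by (auto simp: g_def)
    ultimately show ?thesis by blast
  qed
qed

section \<open>Compact weight boxes, loads and double counting\<close>

text \<open>Pinning the coordinates outside \<open>J\<close> to 0 makes the box compact in the
  product topology on the full function space.\<close>

definition weight_box :: "'j set \<Rightarrow> real \<Rightarrow> ('j \<Rightarrow> real) set" where
  "weight_box J M = {a. (\<forall>j\<in>J. 0 \<le> a j \<and> a j \<le> M) \<and> (\<forall>j. j \<notin> J \<longrightarrow> a j = 0)}"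

lemma compact_weight_box: "compact (weight_box J M)"
proof -
  have "weight_box J M = PiE UNIV (\<lambda>j. if j \<in> J then {0..M} else {0})"
    by (auto simp: weight_box_def PiE_def Pi_def split: if_splits)
  moreover have "compactin (product_topology (\<lambda>_. euclidean) UNIV)
      (PiE UNIV (\<lambda>j::'a. if j \<in> J then {0..M} else {0::real}))"
    by (subst compactin_PiE) auto
  ultimately show ?thesis
    by (simp add: euclidean_product_topology)
qed

text \<open>The load is indexed by \<open>J\<close>, so that edges chosen for several indices count
  with multiplicity.\<close>

definition load :: "'j set \<Rightarrow> ('j \<Rightarrow> 'a set) \<Rightarrow> ('j \<Rightarrow> real) \<Rightarrow> 'a \<Rightarrow> real" where
  "load J e a v = (\<Sum>j\<in>J. of_bool (v \<in> e j) * a j)"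

lemma load_alt: "finite J \<Longrightarrow> load J e a v = sum a {j\<in>J. v \<in> e j}"
  by (simp add: load_def Int_def)

lemma load_add_scaled: "load J e (\<lambda>j. a j + t * h j) v = load J e a v + t * load J e h v"
  by (simp add: load_def sum.distrib sum_distrib_left algebra_simps)

lemma load_nonneg: "(\<And>j. j \<in> J \<Longrightarrow> 0 \<le> a j) \<Longrightarrow> 0 \<le> load J e a v"
  by (simp add: load_def sum_nonneg)

lemma weight_le_load:
  assumes "finite J" "\<And>j. j \<in> J \<Longrightarrow> 0 \<le> a j" "j \<in> J" "v \<in> e j"
  shows "a j \<le> load J e a v"
  using assms by (auto simp: load_alt intro!: member_le_sum)

text \<open>Double counting of incidences. It serves as the handshake identity for constant
  \<open>x\<close> and as the duality pairing when \<open>x\<close> is the excess.\<close>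

lemma sum_load:
  assumes "finite J" "finite W" "\<And>j. j \<in> J \<Longrightarrow> e j \<subseteq> W"
  shows "(\<Sum>v\<in>W. x v * load J e a v) = (\<Sum>j\<in>J. a j * (\<Sum>v\<in>e j. x v))"
proof -
  have "(\<Sum>v\<in>W. x v * load J e a v) = (\<Sum>j\<in>J. \<Sum>v\<in>W. x v * (of_bool (v \<in> e j) * a j))"
    unfolding load_def sum_distrib_left by (rule sum.swap)
  also have "\<dots> = (\<Sum>j\<in>J. a j * (\<Sum>v\<in>e j. x v))"
  proof (rule sum.cong[OF refl])
    fix j assume j: "j \<in> J"
    have "(\<Sum>v\<in>W. x v * (of_bool (v \<in> e j) * a j)) = (\<Sum>v\<in>e j. x v * (of_bool (v \<in> e j) * a j))"
      using assms j by (intro sum.mono_neutral_right) auto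
    then show "(\<Sum>v\<in>W. x v * (of_bool (v \<in> e j) * a j)) = a j * (\<Sum>v\<in>e j. x v)"
      by (simp add: sum_distrib_left mult.commute)
  qed
  finally show ?thesis .
qed

section \<open>Packings and the gap below the target size\<close>

text \<open>An indexed form of fractional matchings; \<open>id\<close> in place of \<open>e\<close>
  gives those on a plain set of edges.\<close>

definition packing :: "'j set \<Rightarrow> ('j \<Rightarrow> 'a set) \<Rightarrow> ('j \<Rightarrow> real) \<Rightarrow> bool" where
  "packing J e a \<longleftrightarrow> (\<forall>j\<in>J. 0 \<le> a j) \<and> (\<forall>v. load J e a v \<le> 1)"

text \<open>The packing constraints depend on \<open>e\<close> only through the set of incidence patterns
  \<open>{j \<in> J. v \<in> e j}\<close>, for which there are finitely many possibilities. This makes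
  the gap independent of \<open>e\<close>.\<close>

lemma packing_gap:
  fixes J :: "'j set" and n :: real
  assumes J: "finite J"
  obtains \<gamma> where "0 < \<gamma>"
    "\<And>(e :: 'j \<Rightarrow> 'a set) a. \<lbrakk>\<And>j. j \<in> J \<Longrightarrow> e j \<noteq> {}; packing J e a; n - \<gamma> < sum a J\<rbrakk>
       \<Longrightarrow> \<exists>b. packing J e b \<and> n \<le> sum b J"
proof -
  define K where "K P = weight_box J 1 \<inter> {a. \<forall>S\<in>P. sum a S \<le> 1}" for P :: "'j set set"
  have "\<exists>\<gamma>>0. (\<exists>a\<in>K P. n - \<gamma> < sum a J) \<longrightarrow> (\<exists>a\<in>K P. n \<le> sum a J)" for P
  proof -
    have "closed (\<Inter>S\<in>P. {a::'j \<Rightarrow> real. sum a S \<le> 1})"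
      by (intro closed_INT ballI closed_Collect_le continuous_intros) auto
    moreover have "(\<Inter>S\<in>P. {a::'j \<Rightarrow> real. sum a S \<le> 1}) = {a. \<forall>S\<in>P. sum a S \<le> 1}"
      by auto
    ultimately have "closed {a::'j \<Rightarrow> real. \<forall>S\<in>P. sum a S \<le> 1}"
      by simp
    then have "compact (K P)"
      unfolding K_def by (intro compact_Int_closed compact_weight_box)
    moreover have "(\<lambda>_. 0) \<in> K P" by (auto simp: K_def weight_box_def)
    moreover have "continuous_on (K P) (\<lambda>a. sum a J)"
      by (intro continuous_intros continuous_on_subset[OF continuous_on_product_coordinates]) auto
    ultimately obtain b where b: "b \<in> K P" "\<forall>a\<in>K P. sum a J \<le> sum b J"
      using continuous_attains_sup[of "K P" "\<lambda>a. sum a J"] by blast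
    show ?thesis
    proof (cases "n \<le> sum b J")
      case True
      then show ?thesis using b by (intro exI[of _ 1]) auto
    next
      \<comment> \<open>The maximum falls short of \<open>n\<close>; with the shortfall as the gap,
        the premise becomes false.\<close>
      case False
      then show ?thesis using b by (intro exI[of _ "n - sum b J"]) force
    qed
  qed
  then obtain \<gamma> where \<gamma>: "\<And>P. 0 < \<gamma> P"
    "\<And>P. (\<exists>a\<in>K P. n - \<gamma> P < sum a J) \<Longrightarrow> (\<exists>a\<in>K P. n \<le> sum a J)"
    by metis
  define \<gamma>0 where "\<gamma>0 = Min (\<gamma> ` Pow (Pow J))"
  show ?thesis
  proof
    show "0 < \<gamma>0" unfolding \<gamma>0_def using \<gamma>(1) J by (subst Min_gr_iff) auto
  next
    fix e :: "'j \<Rightarrow> 'a set" and a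
    assume e: "\<And>j. j \<in> J \<Longrightarrow> e j \<noteq> {}" and a: "packing J e a" and n: "n - \<gamma>0 < sum a J"
    define P where "P = range (\<lambda>v. {j\<in>J. v \<in> e j})"
    \<comment> \<open>Values outside \<open>J\<close> are reset to 0, as \<open>weight_box\<close>
      demands.\<close>
    define a' where "a' = (\<lambda>j. if j \<in> J then a j else 0)"
    have "\<gamma>0 \<le> \<gamma> P"
      unfolding \<gamma>0_def using J by (intro Min_le) (auto simp: P_def)
    moreover have a': "sum a' J = sum a J" by (simp add: a'_def)
    moreover have "a' \<in> K P"
    proof -
      have "a j \<le> 1" if j: "j \<in> J" for j
      proof -
        obtain v where "v \<in> e j" using e j by blast
        then have "a j \<le> load J e a v"
          using a j by (intro weight_le_load[OF J]) (auto simp: packing_def)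
        then show ?thesis using a by (auto simp: packing_def intro: order_trans)
      qed
      moreover have "sum a' {j\<in>J. v \<in> e j} \<le> 1" for v
      proof -
        have "sum a' {j\<in>J. v \<in> e j} = load J e a v"
          by (simp add: load_alt J a'_def)
        then show ?thesis using a by (simp add: packing_def)
      qed
      ultimately show ?thesis
        using a by (auto simp: K_def weight_box_def a'_def P_def packing_def)
    qed
    ultimately obtain b where b: "b \<in> K P" "n \<le> sum b J"
      using \<gamma>(2)[of P] n by force
    have "packing J e b"
      using b(1) J by (auto simp: packing_def K_def weight_box_def P_def load_alt)
    then show "\<exists>b. packing J e b \<and> n \<le> sum b J" using b by blast
  qed
qed

section \<open>First-order conditions for the penalized problem\<close>

text \<open>For either sign of \<open>t\<close>, \<open>max 0 (x + t)\<close> is at most the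
  absolute value of \<open>max 0 x + t\<close>.\<close>

lemma square_pos_part_add_le:
  fixes x t :: real
  shows "(max 0 (x + t))\<^sup>2 \<le> (max 0 x)\<^sup>2 + 2 * t * max 0 x + t\<^sup>2"
proof -
  have "(max 0 (x + t))\<^sup>2 \<le> (max 0 x + t)\<^sup>2"
    by (rule abs_le_square_iff[THEN iffD1]) (auto simp: max_def)
  then show ?thesis by (simp add: power2_sum algebra_simps)
qed

locale rainbow_penalty =
  fixes J :: "'j set" and F :: "'j \<Rightarrow> 'a set set" and c :: real
  assumes finite_index: "finite J"
    and finite_edges: "j \<in> J \<Longrightarrow> finite (F j)"
    and edges_nonempty: "j \<in> J \<Longrightarrow> F j \<noteq> {}"
    and card_edge: "\<lbrakk>j \<in> J; f \<in> F j\<rbrakk> \<Longrightarrow> card f = 2"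
    and c_pos: "0 < c" and c_le_1: "c \<le> 1"
begin

definition W :: "'a set" where "W = (\<Union>j\<in>J. \<Union>(F j))"

definition excess :: "('j \<Rightarrow> 'a set) \<Rightarrow> ('j \<Rightarrow> real) \<Rightarrow> 'a \<Rightarrow> real" where
  "excess e a v = max 0 (load J e a v - 1)"

definition penalty :: "('j \<Rightarrow> 'a set) \<Rightarrow> ('j \<Rightarrow> real) \<Rightarrow> real" where
  "penalty e a = (\<Sum>v\<in>W. (excess e a v)\<^sup>2) - c * sum a J"

text \<open>The cap 2 only provides compactness: as \<open>c \<le> 1\<close>, the loads of a
  minimizer turn out to be at most 3/2, so no weight reaches the cap.\<close>

definition minimizer :: "('j \<Rightarrow> 'a set) \<Rightarrow> ('j \<Rightarrow> real) \<Rightarrow> bool" where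
  "minimizer e a \<longleftrightarrow> e \<in> PiE J F \<and> a \<in> weight_box J 2 \<and>
     (\<forall>e'\<in>PiE J F. \<forall>a'\<in>weight_box J 2. penalty e a \<le> penalty e' a')"

lemma finite_edge: "\<lbrakk>j \<in> J; f \<in> F j\<rbrakk> \<Longrightarrow> finite f"
  using card_edge by (metis card.infinite zero_neq_numeral)

lemma finite_W: "finite W"
  unfolding W_def using finite_index finite_edges finite_edge by blast

lemma edge_subset_W: "\<lbrakk>j \<in> J; f \<in> F j\<rbrakk> \<Longrightarrow> f \<subseteq> W"
  by (auto simp: W_def)

lemma excess_nonneg: "0 \<le> excess e a v"
  by (simp add: excess_def)

lemma minimizer_nonneg: "minimizer e a \<Longrightarrow> j \<in> J \<Longrightarrow> 0 \<le> a j"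
  by (auto simp: minimizer_def weight_box_def)

lemma minimizer_le_2: "minimizer e a \<Longrightarrow> j \<in> J \<Longrightarrow> a j \<le> 2"
  by (auto simp: minimizer_def weight_box_def)

lemma minimizer_edge: "minimizer e a \<Longrightarrow> j \<in> J \<Longrightarrow> e j \<in> F j"
  by (auto simp: minimizer_def)

text \<open>Compactness yields optimal weights for each choice \<open>e\<close>, and only finitely
  many choices compete.\<close>

lemma ex_minimizer: "\<exists>e a. minimizer e a"
proof -
  have "\<exists>a\<in>weight_box J 2. \<forall>a'\<in>weight_box J 2. penalty e a \<le> penalty e a'" for e
  proof (rule continuous_attains_inf)
    show "weight_box J 2 \<noteq> {}" by (auto simp: weight_box_def intro!: exI[of _ "\<lambda>_. 0"])
    show "continuous_on (weight_box J 2) (penalty e)"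
      unfolding penalty_def excess_def load_def
      by (intro continuous_intros continuous_on_subset[OF continuous_on_product_coordinates]) auto
  qed (rule compact_weight_box)
  then obtain A where A: "\<And>e. A e \<in> weight_box J 2" "\<And>e a'. a' \<in> weight_box J 2 \<Longrightarrow> penalty e (A e) \<le> penalty e a'"
    by metis
  have "finite (PiE J F)" "PiE J F \<noteq> {}"
    using finite_index finite_edges edges_nonempty by (auto intro: finite_PiE simp: PiE_eq_empty_iff)
  then obtain e where e: "e \<in> PiE J F" "\<And>e'. e' \<in> PiE J F \<Longrightarrow> penalty e (A e) \<le> penalty e' (A e')"
    using ex_is_arg_min_if_finite[of "PiE J F" "\<lambda>e. penalty e (A e)"]
    by (auto simp: is_arg_min_linorder)
  have "minimizer e (A e)"
    unfolding minimizer_def using e A by (meson order_trans)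
  then show ?thesis by blast
qed

text \<open>Compare with the weight of \<open>j\<close> shifted by \<open>t\<close>. The quadratic
  term is \<open>2 * t\<^sup>2\<close> because the edge has two ends.\<close>

lemma minimizer_variation:
  assumes m: "minimizer e a" and j: "j \<in> J" and t: "0 \<le> a j + t" "a j + t \<le> 2"
  shows "0 \<le> t * (2 * (\<Sum>v\<in>e j. excess e a v) - c) + 2 * t\<^sup>2"
proof -
  define a' where "a' = a(j := a j + t)"
  have a': "a' = (\<lambda>i. a i + t * of_bool (i = j))" by (auto simp: a'_def)
  have "load J e a' v = load J e a v + t * of_bool (v \<in> e j)" for v
  proof -
    have "load J e (\<lambda>i. of_bool (i = j)) v = (\<Sum>i\<in>J. if i = j then of_bool (v \<in> e j) else 0)"
      unfolding load_def by (intro sum.cong) auto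
    then show ?thesis
      unfolding a' load_add_scaled using j finite_index by simp
  qed
  then have "(excess e a' v)\<^sup>2 \<le>
      (excess e a v)\<^sup>2 + of_bool (v \<in> e j) * (2 * t * excess e a v + t\<^sup>2)" for v
    using square_pos_part_add_le[of "load J e a v - 1" t]
    by (cases "v \<in> e j") (auto simp: excess_def algebra_simps)
  then have "(\<Sum>v\<in>W. (excess e a' v)\<^sup>2) \<le>
      (\<Sum>v\<in>W. (excess e a v)\<^sup>2 + of_bool (v \<in> e j) * (2 * t * excess e a v + t\<^sup>2))"
    by (intro sum_mono)
  also have "\<dots> = (\<Sum>v\<in>W. (excess e a v)\<^sup>2) + (\<Sum>v\<in>W. of_bool (v \<in> e j) * (2 * t * excess e a v + t\<^sup>2))"
    by (simp add: sum.distrib)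
  also have "(\<Sum>v\<in>W. of_bool (v \<in> e j) * (2 * t * excess e a v + t\<^sup>2)) =
      (\<Sum>v\<in>e j. of_bool (v \<in> e j) * (2 * t * excess e a v + t\<^sup>2))"
    using finite_W edge_subset_W[OF j minimizer_edge[OF m j]]
    by (intro sum.mono_neutral_right) auto
  also have "\<dots> = 2 * t * (\<Sum>v\<in>e j. excess e a v) + 2 * t\<^sup>2"
    using card_edge[OF j minimizer_edge[OF m j]] by (simp add: sum.distrib sum_distrib_left)
  finally have 1: "(\<Sum>v\<in>W. (excess e a' v)\<^sup>2) \<le>
      (\<Sum>v\<in>W. (excess e a v)\<^sup>2) + (2 * t * (\<Sum>v\<in>e j. excess e a v) + 2 * t\<^sup>2)" by simp
  have 2: "sum a' J = sum a J + t"
    using j finite_index by (simp add: a' sum.distrib sum_distrib_left[symmetric])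
  have "a' \<in> weight_box J 2"
    using m t j by (auto simp: minimizer_def weight_box_def a'_def)
  then have "penalty e a \<le> penalty e a'"
    using m by (auto simp: minimizer_def)
  then show ?thesis
    using 1 2 by (simp add: penalty_def algebra_simps)
qed

text \<open>Otherwise lowering the weight of \<open>j\<close> slightly would reduce the
  penalty.\<close>

lemma excess_le_if_pos:
  assumes m: "minimizer e a" and j: "j \<in> J" and "0 < a j"
  shows "2 * (\<Sum>v\<in>e j. excess e a v) \<le> c"
proof (rule ccontr)
  let ?s = "2 * (\<Sum>v\<in>e j. excess e a v) - c"
  assume "\<not> ?thesis"
  then have s: "0 < ?s" by simp
  \<comment> \<open>With \<open>4 * t \<le> ?s\<close> the quadratic term cannot offset the linear
    gain.\<close>
  define t where "t = min (a j) (?s / 4)"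
  have t: "0 < t" "t \<le> a j" "4 * t \<le> ?s"
    using s assms by (auto simp: t_def min_def)
  have "0 \<le> - t * ?s + 2 * (- t)\<^sup>2"
    by (rule minimizer_variation[OF m j])
       (use t minimizer_le_2[OF m j] in auto)
  then have "0 \<le> t * (2 * t - ?s)" by (simp add: power2_eq_square algebra_simps)
  then show False using t by (simp add: zero_le_mult_iff)
qed

lemma load_le_if_incident:
  assumes m: "minimizer e a" and j: "j \<in> J" "0 < a j" and v: "v \<in> e j"
  shows "load J e a v \<le> 1 + c / 2"
proof -
  have "excess e a v \<le> (\<Sum>v\<in>e j. excess e a v)"
    using v finite_edge[OF j(1) minimizer_edge[OF m j(1)]]
    by (intro member_le_sum) (auto simp: excess_nonneg)
  then show ?thesis using excess_le_if_pos[OF m j] by (simp add: excess_def)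
qed

lemma minimizer_load_le:
  assumes m: "minimizer e a"
  shows "load J e a v \<le> 1 + c / 2"
proof (cases "\<exists>j\<in>J. v \<in> e j \<and> 0 < a j")
  case True
  then show ?thesis using load_le_if_incident[OF m] by blast
next
  case False
  then have "load J e a v \<le> 0"
    unfolding load_def by (intro sum_nonpos) (force simp: not_less)
  then show ?thesis using c_pos by simp
qed

lemma edge_obtain_vertex:
  assumes "minimizer e a" "j \<in> J"
  obtains v where "v \<in> e j"
  using card_edge[OF assms(2) minimizer_edge[OF assms]] by fastforce

text \<open>Raising the weight of \<open>j\<close> must not pay off. Zero weight is allowed, so the
  bound also applies to an edge newly swapped in at an idle index.\<close>

lemma excess_ge:
  assumes m: "minimizer e a" and j: "j \<in> J"
  shows "c \<le> 2 * (\<Sum>v\<in>e j. excess e a v)"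
proof (rule ccontr)
  let ?s = "c - 2 * (\<Sum>v\<in>e j. excess e a v)"
  assume "\<not> ?thesis"
  then have s: "0 < ?s" by simp
  \<comment> \<open>There is room to raise the weight: it is at most the load of an end, hence at
    most 3/2.\<close>
  have a2: "a j < 2"
  proof -
    obtain v where "v \<in> e j" using edge_obtain_vertex[OF m j] .
    then have "a j \<le> load J e a v"
      using minimizer_nonneg[OF m] j by (intro weight_le_load[OF finite_index])
    then show ?thesis using minimizer_load_le[OF m, of v] c_le_1 by simp
  qed
  define t where "t = min (2 - a j) (?s / 4)"
  have t: "0 < t" "t \<le> 2 - a j" "4 * t \<le> ?s"
    using s a2 by (auto simp: t_def min_def)
  have "0 \<le> t * (2 * (\<Sum>v\<in>e j. excess e a v) - c) + 2 * t\<^sup>2"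
    by (rule minimizer_variation[OF m j])
       (use t minimizer_nonneg[OF m j] in auto)
  then have "0 \<le> t * (2 * t - ?s)" by (simp add: power2_eq_square algebra_simps)
  then show False using t by (simp add: zero_le_mult_iff)
qed

lemma excess_eq_if_pos:
  assumes "minimizer e a" "j \<in> J" "0 < a j"
  shows "(\<Sum>v\<in>e j. excess e a v) = c / 2"
  using excess_ge[OF assms(1,2)] excess_le_if_pos[OF assms] by simp

section \<open>Minimizers of small support and weak duality\<close>

definition support :: "('j \<Rightarrow> real) \<Rightarrow> 'j set" where "support a = {j\<in>J. 0 < a j}"

text \<open>Load exactly 1 is included, since there any increase already creates excess.\<close>

definition saturated :: "('j \<Rightarrow> 'a set) \<Rightarrow> ('j \<Rightarrow> real) \<Rightarrow> 'a set" where
  "saturated e a = {v\<in>W. 1 \<le> load J e a v}"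

lemma finite_support: "finite (support a)"
  using finite_index by (simp add: support_def)

lemma finite_saturated: "finite (saturated e a)"
  using finite_W by (simp add: saturated_def)

text \<open>A kernel vector of the saturated constraints leaves the penalty unchanged, so one
  can move along it until a weight vanishes or a further vertex gets saturated.\<close>

lemma minimizer_improve:
  assumes m: "minimizer e a" and less: "card (saturated e a) < card (support a)"
  shows "\<exists>b. minimizer e b \<and> support b \<subseteq> support a \<and> saturated e a \<subseteq> saturated e b \<and>
    (support b \<noteq> support a \<or> saturated e b \<noteq> saturated e a)"
proof -
  let ?S = "support a" and ?T = "saturated e a"
  \<comment> \<open>The unknowns are the weights on the support, the equations belong to the
    saturated vertices, and there are fewer equations than unknowns.\<close>
  obtain h0 where h0: "\<exists>j\<in>?S. h0 j \<noteq> 0" "\<forall>v\<in>?T. (\<Sum>j\<in>?S. of_bool (v \<in> e j) * h0 j) = (0::real)"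
    using homogeneous_system_nontrivial_solution[OF finite_saturated finite_support less,
        of "\<lambda>j v. of_bool (v \<in> e j)"] by auto
  obtain i where i: "i \<in> ?S" "h0 i \<noteq> 0" using h0 by blast
  \<comment> \<open>The sign makes \<open>h i\<close> negative, so a move along \<open>h\<close>
    lowers some weight and cannot go on forever.\<close>
  define h where "h j = (if j \<in> ?S then - sgn (h0 i) * h0 j else 0)" for j
  have hi: "h i < 0" using i by (auto simp: h_def sgn_if)
  have S_sub: "?S \<subseteq> J" by (auto simp: support_def)
  have hT: "load J e h v = 0" if "v \<in> ?T" for v
  proof -
    have "load J e h v = (\<Sum>j\<in>?S. of_bool (v \<in> e j) * h j)"
      unfolding load_def using S_sub finite_index
      by (intro sum.mono_neutral_right) (auto simp: h_def)
    also have "\<dots> = - sgn (h0 i) * (\<Sum>j\<in>?S. of_bool (v \<in> e j) * h0 j)"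
      unfolding sum_distrib_left by (intro sum.cong) (auto simp: h_def)
    finally show ?thesis using h0(2) that by simp
  qed
  have ex0: "excess e a v = 0" if "v \<in> W" "v \<notin> ?T" for v
    using that by (auto simp: saturated_def excess_def)
  have sub: "\<And>j. j \<in> J \<Longrightarrow> e j \<subseteq> W"
    using edge_subset_W minimizer_edge[OF m] by blast
  \<comment> \<open>Complementary slackness: on the support the excesses of the two ends sum to
    \<open>c / 2\<close>, while \<open>h\<close> adds no load where there is excess. Double counting
    then gives total 0.\<close>
  have sum_h: "sum h J = 0"
  proof -
    have "(\<Sum>j\<in>J. h j * (\<Sum>v\<in>e j. excess e a v)) = (\<Sum>j\<in>J. h j * (c / 2))"
      using excess_eq_if_pos[OF m] by (intro sum.cong) (auto simp: h_def support_def)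
    moreover have "(\<Sum>v\<in>W. excess e a v * load J e h v) = 0"
      using hT ex0 by (intro sum.neutral) force
    ultimately have "sum h J * (c / 2) = 0"
      using sum_load[OF finite_index finite_W, of e "excess e a" h] sub
      by (simp add: sum_distrib_right sum_divide_distrib)
    then show ?thesis using c_pos by simp
  qed
  \<comment> \<open>Ratio test: the step lengths at which a falling weight vanishes or an
    unsaturated vertex reaches load 1.\<close>
  define Q where "Q = (\<lambda>j. a j / - h j) ` {j\<in>?S. h j < 0} \<union>
      (\<lambda>v. (1 - load J e a v) / load J e h v) ` {v\<in>W - ?T. 0 < load J e h v}"
  define t where "t = Min Q"
  have Q: "finite Q" "Q \<noteq> {}"
    using finite_support finite_W i hi by (auto simp: Q_def)
  have "\<forall>q\<in>Q. 0 < q"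
    by (auto simp: Q_def support_def saturated_def divide_pos_neg)
  then have t: "0 < t" "t \<in> Q" "\<And>q. q \<in> Q \<Longrightarrow> t \<le> q"
    using Q by (auto simp: t_def)
  define b where "b = (\<lambda>j. a j + t * h j)"
  have load_b: "load J e b v = load J e a v + t * load J e h v" for v
    unfolding b_def by (rule load_add_scaled)
  have b_nonneg: "0 \<le> b j" if "j \<in> J" for j
  proof (cases "h j < 0")
    case True
    then have "j \<in> ?S" by (auto simp: h_def split: if_splits)
    then have "t \<le> a j / - h j" using True by (intro t(3)) (auto simp: Q_def)
    then show ?thesis using True by (simp add: b_def field_simps)
  next
    case False
    then show ?thesis using t minimizer_nonneg[OF m that] by (simp add: b_def)
  qed
  have load_b_T: "load J e b v = load J e a v" if "v \<in> ?T" for v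
    using hT[OF that] by (simp add: load_b)
  have load_b_nT: "load J e b v \<le> 1" if "v \<in> W" "v \<notin> ?T" for v
  proof (cases "0 < load J e h v")
    case True
    then have "t \<le> (1 - load J e a v) / load J e h v"
      using that by (intro t(3)) (auto simp: Q_def)
    then show ?thesis using True by (simp add: load_b field_simps)
  next
    case False
    then have "t * load J e h v \<le> 0" using t by (simp add: mult_le_0_iff)
    moreover have "load J e a v < 1" using that by (auto simp: saturated_def)
    ultimately show ?thesis by (simp add: load_b)
  qed
  have b_le: "b j \<le> 2" if j: "j \<in> J" for j
  proof -
    obtain v where v: "v \<in> e j" using edge_obtain_vertex[OF m j] .
    then have "b j \<le> load J e b v"
      using b_nonneg j by (intro weight_le_load[OF finite_index])
    moreover have "load J e b v \<le> 1 + c / 2"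
    proof (cases "v \<in> ?T")
      case True
      then show ?thesis using load_b_T minimizer_load_le[OF m] by simp
    next
      case False
      moreover have "v \<in> W" using sub[OF j] v by blast
      ultimately show ?thesis using load_b_nT[of v] c_pos by simp
    qed
    ultimately show ?thesis using c_le_1 by simp
  qed
  have "b \<in> weight_box J 2"
    using b_nonneg b_le m S_sub by (auto simp: weight_box_def minimizer_def b_def h_def)
  moreover have "excess e b v = excess e a v" if "v \<in> W" for v
    using that load_b_T[of v] load_b_nT[of v] ex0[of v]
    by (cases "v \<in> ?T") (auto simp: excess_def)
  then have "penalty e b = penalty e a"
    using sum_h by (simp add: penalty_def b_def sum.distrib sum_distrib_left[symmetric])
  ultimately have mb: "minimizer e b"
    using m by (simp add: minimizer_def)
  have "support b \<subseteq> ?S"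
    by (auto simp: support_def b_def h_def split: if_splits)
  moreover have "?T \<subseteq> saturated e b"
    using load_b_T by (auto simp: saturated_def)
  moreover have "support b \<noteq> ?S \<or> saturated e b \<noteq> ?T"
  proof -
    consider j where "j \<in> ?S" "h j < 0" "t = a j / - h j" |
      v where "v \<in> W - ?T" "0 < load J e h v" "t = (1 - load J e a v) / load J e h v"
      using t(2) by (auto simp: Q_def)
    then show ?thesis
    proof cases
      case 1
      then have "b j = 0" by (simp add: b_def)
      then have "j \<notin> support b" by (simp add: support_def)
      then show ?thesis using 1 by blast
    next
      case 2
      then have "load J e b v = 1" by (simp add: load_b)
      then have "v \<in> saturated e b" using 2 by (simp add: saturated_def)
      then show ?thesis using 2 by blast
    qed
  qed
  ultimately show ?thesis using mb by blast
qed

text \<open>Each application of \<open>minimizer_improve\<close> strictly lowers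
  \<open>\<mu>\<close>, so a minimizer with least \<open>\<mu>\<close> has small support.\<close>

lemma ex_minimizer_small_support:
  "\<exists>e a. minimizer e a \<and> card (support a) \<le> card (saturated e a)"
proof -
  define \<mu> where "\<mu> = (\<lambda>(e, a). card (support a) + card (W - saturated e a))"
  obtain p where p: "minimizer (fst p) (snd p)"
    "\<And>q. minimizer (fst q) (snd q) \<Longrightarrow> \<mu> p \<le> \<mu> q"
    using ex_has_least_nat[of "\<lambda>q. minimizer (fst q) (snd q)" _ \<mu>] ex_minimizer
    by fastforce
  obtain e a where ea: "p = (e, a)" by fastforce
  have "card (support a) \<le> card (saturated e a)"
  proof (rule ccontr)
    assume "\<not> ?thesis"
    then obtain b where b: "minimizer e b" "support b \<subseteq> support a" "saturated e a \<subseteq> saturated e b"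
      "support b \<noteq> support a \<or> saturated e b \<noteq> saturated e a"
      using minimizer_improve[of e a] p(1) ea by auto
    have "W - saturated e b \<subset> W - saturated e a \<or> support b \<subset> support a"
      using b by (auto simp: saturated_def)
    then have "card (W - saturated e b) < card (W - saturated e a) \<or> card (support b) < card (support a)"
      using finite_W finite_support by (meson finite_Diff psubset_card_mono)
    moreover have "card (W - saturated e b) \<le> card (W - saturated e a)" "card (support b) \<le> card (support a)"
      using b finite_W finite_support by (auto intro!: card_mono)
    ultimately have "\<mu> (e, b) < \<mu> (e, a)" by (auto simp: \<mu>_def)
    then show False using p(2)[of "(e, b)"] b(1) ea by simp
  qed
  then show ?thesis using p(1) ea by auto
qed

text \<open>If the index \<open>i\<close> carries no weight, every edge of \<open>F i\<close> may replace
  \<open>e i\<close>. Hence the excesses, rescaled by \<open>2 / c\<close>, cover \<open>F i\<close> fractionally, and weak duality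
  applies to any packing of \<open>F i\<close>.\<close>

lemma minimizer_size_ge:
  assumes m: "minimizer e a" and i: "i \<in> J" "a i = 0" and h: "packing (F i) id h"
  shows "sum h (F i) \<le> sum a J"
proof -
  \<comment> \<open>Index \<open>i\<close> is idle, so swapping in \<open>f\<close> changes no load
    and gives another minimizer, to which \<open>excess_ge\<close> applies.\<close>
  have cover: "c / 2 \<le> (\<Sum>v\<in>f. excess e a v)" if f: "f \<in> F i" for f
  proof -
    let ?e = "e(i := f)"
    have l: "load J ?e a v = load J e a v" for v
      unfolding load_def using i by (intro sum.cong) auto
    have ex: "excess ?e a = excess e a"
      by (simp add: fun_eq_iff excess_def l)
    then have "penalty ?e a = penalty e a" by (simp add: penalty_def)
    moreover have "?e \<in> PiE J F"
      using m f i by (auto simp: minimizer_def PiE_def extensional_def)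
    ultimately have "minimizer ?e a" using m by (simp add: minimizer_def)
    from excess_ge[OF this i(1)] show ?thesis by (simp add: ex)
  qed
  have "c / 2 * sum h (F i) = (\<Sum>f\<in>F i. h f * (c / 2))"
    by (simp add: sum_distrib_left mult_ac)
  also have "\<dots> \<le> (\<Sum>f\<in>F i. h f * (\<Sum>v\<in>id f. excess e a v))"
    using h cover by (intro sum_mono mult_left_mono) (auto simp: packing_def)
  also have "\<dots> = (\<Sum>v\<in>W. excess e a v * load (F i) id h v)"
    using sum_load[OF finite_edges[OF i(1)] finite_W, of id] edge_subset_W[OF i(1)] by simp
  \<comment> \<open>Wherever the excess is positive, the load under \<open>a\<close> exceeds 1,
    which in turn bounds the load under \<open>h\<close>.\<close>
  also have "\<dots> \<le> (\<Sum>v\<in>W. excess e a v * load J e a v)"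
  proof (rule sum_mono)
    fix v
    have "load (F i) id h v \<le> 1" using h by (simp add: packing_def)
    then show "excess e a v * load (F i) id h v \<le> excess e a v * load J e a v"
      by (cases "load J e a v \<le> 1") (auto simp: excess_def intro!: mult_left_mono)
  qed
  also have "\<dots> = (\<Sum>j\<in>J. a j * (\<Sum>v\<in>e j. excess e a v))"
    using finite_index finite_W edge_subset_W minimizer_edge[OF m]
    by (intro sum_load) blast+
  \<comment> \<open>Complementary slackness: zero weights contribute nothing, positive ones make the
    cover condition tight.\<close>
  also have "\<dots> = (\<Sum>j\<in>J. a j * (c / 2))"
    using excess_eq_if_pos[OF m] minimizer_nonneg[OF m]
    by (intro sum.cong) (force simp: le_less)+
  also have "\<dots> = c / 2 * sum a J"
    by (simp add: sum_distrib_left mult_ac)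
  finally show ?thesis using c_pos by simp
qed

section \<open>Rainbow packings of nearly the target size\<close>

text \<open>Twice the total weight bounds the number of saturated vertices, hence the size of the
  support. A total below \<open>s\<close> would thus leave some index idle, contradicting
  \<open>minimizer_size_ge\<close>.\<close>

lemma ex_large_rainbow:
  assumes h: "\<And>i. i \<in> J \<Longrightarrow> packing (F i) id (h i)" "\<And>i. i \<in> J \<Longrightarrow> s \<le> sum (h i) (F i)"
    and s: "2 * s \<le> real (card J)"
  shows "\<exists>e a. e \<in> PiE J F \<and> packing J e a \<and> s \<le> (1 + c / 2) * sum a J"
proof -
  obtain e a where m: "minimizer e a" and card: "card (support a) \<le> card (saturated e a)"
    using ex_minimizer_small_support by blast
  have "s \<le> sum a J"
  proof (rule ccontr)
    assume less: "\<not> ?thesis"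
    have "real (card (saturated e a)) \<le> (\<Sum>v\<in>saturated e a. load J e a v)"
      using sum_mono[of "saturated e a" "\<lambda>_. 1" "load J e a"] by (simp add: saturated_def)
    also have "\<dots> \<le> (\<Sum>v\<in>W. load J e a v)"
      using finite_W minimizer_nonneg[OF m]
      by (intro sum_mono2) (auto simp: saturated_def intro!: load_nonneg)
    also have "\<dots> = (\<Sum>j\<in>J. a j * (\<Sum>v\<in>e j. 1))"
      using sum_load[OF finite_index finite_W, of e "\<lambda>_. 1" a] edge_subset_W minimizer_edge[OF m]
      by simp
    also have "\<dots> = 2 * sum a J"
      using card_edge minimizer_edge[OF m] by (simp add: sum_distrib_left mult.commute[of 2])
    also have "\<dots> < real (card J)" using less s by simp
    finally have "card (support a) < card J" using card by simp
    then obtain i where "i \<in> J" "i \<notin> support a"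
      by (metis card_mono finite_support linorder_not_less subsetI)
    then have "i \<in> J" "a i = 0"
      using minimizer_nonneg[OF m, of i] by (auto simp: support_def)
    from minimizer_size_ge[OF m this h(1)] h(2)[of i] less \<open>i \<in> J\<close>
    show False by simp
  qed
  \<comment> \<open>No load exceeds \<open>k\<close>, so dividing the weights by \<open>k\<close>
    yields a packing.\<close>
  define k where "k = 1 + c / 2"
  have k: "0 < k" using c_pos by (simp add: k_def)
  have "load J e (\<lambda>j. a j / k) v = load J e a v / k" for v
    by (simp add: load_def sum_divide_distrib)
  moreover have "load J e a v \<le> k" for v
    using minimizer_load_le[OF m] by (simp add: k_def)
  ultimately have "packing J e (\<lambda>j. a j / k)"
    using k minimizer_nonneg[OF m] by (simp add: packing_def)
  moreover have "k * (\<Sum>j\<in>J. a j / k) = sum a J"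
    using k by (simp add: sum_divide_distrib[symmetric])
  ultimately show ?thesis
    using m \<open>s \<le> sum a J\<close> unfolding k_def[symmetric]
    by (intro exI[of _ e] exI[of _ "\<lambda>j. a j / k"]) (simp add: minimizer_def)
qed

end

section \<open>Passing between fractional matchings and packings\<close>

text \<open>Both the supremum and the infinite sum are approached from below, so any size strictly
  under \<open>n\<close> is exceeded on a finite set of edges. This supplies the finite sets that
  the penalty argument requires.\<close>

lemma ex_finite_packing:
  assumes "ennreal n \<le> fractional_matching_number E" "0 \<le> s" "s < n"
  shows "\<exists>F h. finite F \<and> F \<subseteq> E \<and> packing F id h \<and> s < sum h F"
proof -
  have "ennreal s < Sup {matching_size E f | f. fractional_matching E f}"
    using assms by (auto simp: fractional_matching_number_def intro!: less_le_trans[of _ "ennreal n"] ennreal_lessI)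
  then obtain f where f: "fractional_matching E f" "ennreal s < matching_size E f"
    by (auto simp: less_Sup_iff)
  then obtain F where F: "finite F" "F \<subseteq> E" "ennreal s < (\<Sum>e\<in>F. ennreal (f e))"
    by (auto simp: matching_size_def nonneg_infsum_complete less_SUP_iff)
  have nonneg: "\<forall>e\<in>F. 0 \<le> f e"
    using f(1) F(2) by (auto simp: fractional_matching_def)
  have "load F id f v \<le> 1" for v
  proof -
    have "ennreal (load F id f v) = (\<Sum>e\<in>{e\<in>F. v \<in> e}. ennreal (f e))"
      using F nonneg by (subst sum_ennreal) (auto simp: load_alt)
    also have "\<dots> \<le> (\<Sum>\<^sub>\<infinity>e\<in>{e\<in>E. v \<in> e}. ennreal (f e))"
      using F by (subst nonneg_infsum_complete) (auto intro!: SUP_upper)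
    also have "\<dots> \<le> 1" using f(1) by (simp add: fractional_matching_def)
    finally show ?thesis by simp
  qed
  then have "packing F id f" using nonneg by (simp add: packing_def)
  moreover have "s < sum f F"
    using F nonneg assms by (simp add: sum_ennreal ennreal_less_iff)
  ultimately show ?thesis using F by blast
qed

lemma rainbow_if_packing:
  assumes e: "\<And>j. j \<in> {1..m} \<Longrightarrow> e j \<in> E j" and a: "packing {1..m} e a" and n: "sum a {1..m} = n"
  shows "has_rainbow_fractional_matching m E n"
proof -
  \<comment> \<open>Different indices may choose the same edge, so the weights over each fibre of
    \<open>e\<close> are added up.\<close>
  define f where "f x = (\<Sum>j\<in>{j\<in>{1..m}. e j = x}. a j)" for x
  have nonneg: "0 \<le> f x" for x
    using a by (auto simp: f_def packing_def intro!: sum_nonneg)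
  have "(\<Sum>x\<in>{x\<in>e ` {1..m}. v \<in> x}. f x) \<le> 1" for v
  proof -
    have "(\<Sum>x\<in>{x\<in>e ` {1..m}. v \<in> x}. f x) =
        (\<Sum>x\<in>{x\<in>e ` {1..m}. v \<in> x}. \<Sum>j\<in>{j\<in>{j\<in>{1..m}. v \<in> e j}. e j = x}. a j)"
      by (intro sum.cong) (auto simp: f_def intro!: sum.cong)
    also have "\<dots> = load {1..m} e a v"
      unfolding load_alt[OF finite_atLeastAtMost] by (rule sum.group) auto
    finally show ?thesis using a by (simp add: packing_def)
  qed
  then have "fractional_matching (e ` {1..m}) f"
    using nonneg by (simp add: fractional_matching_finite)
  moreover have "matching_size (e ` {1..m}) f = ennreal n"
    unfolding matching_size_finite[OF finite_imageI[OF finite_atLeastAtMost] nonneg] n[symmetric] f_def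
    by (subst sum.group) auto
  ultimately show ?thesis
    unfolding has_rainbow_fractional_matching_def using e
    by (intro exI[of _ m] exI[of _ e] exI[of _ id] exI[of _ f]) auto
qed

section \<open>Choice of parameters and crossing the gap\<close>

theorem theorem5:
  fixes n :: real and m :: nat
    and V :: "'a set" and D :: "'a set set" and E :: "nat \<Rightarrow> 'a set set"
  assumes "0 < m" and "2 * n = real m"
    and "simple_graph V D"
    and "\<And>i. i \<in> {1..m} \<Longrightarrow> E i \<subseteq> D"
    and "\<And>i. i \<in> {1..m} \<Longrightarrow> fractional_matching_number (E i) \<ge> ennreal n"
  shows "has_rainbow_fractional_matching m E n"
proof -
  have n: "0 < n" using assms by simp
  have edge: "card f = 2" if "i \<in> {1..m}" "f \<in> E i" for i f
    using assms(3,4) that by (auto simp: simple_graph_def)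
  obtain \<gamma> where \<gamma>: "0 < \<gamma>"
    "\<And>(e :: nat \<Rightarrow> 'a set) a. \<lbrakk>\<And>j. j \<in> {1..m} \<Longrightarrow> e j \<noteq> {}; packing {1..m} e a; n - \<gamma> < sum a {1..m}\<rbrakk>
       \<Longrightarrow> \<exists>b. packing {1..m} e b \<and> n \<le> sum b {1..m}"
    using packing_gap[of "{1..m}" n] by auto
  \<comment> \<open>Both losses fit into the gap: \<open>s\<close> is at most
    \<open>\<gamma> / 2\<close> below \<open>n\<close>, and \<open>c * n\<close> is at most
    \<open>\<gamma> / 2\<close>. The term \<open>n / 2\<close> keeps \<open>s\<close> positive,
    which makes every \<open>F i\<close> nonempty.\<close>
  define s where "s = n - min (n / 2) (\<gamma> / 2)"
  define c where "c = min 1 (\<gamma> / (2 * n))"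
  have s: "0 < s" "s < n" "n - \<gamma> / 2 \<le> s"
    using n \<gamma>(1) by (auto simp: s_def)
  have c: "0 < c" "c \<le> 1" "c * n \<le> \<gamma> / 2"
    using n \<gamma>(1) by (auto simp: c_def min_def field_simps)
  have "\<forall>i\<in>{1..m}. \<exists>F h. finite F \<and> F \<subseteq> E i \<and> packing F id h \<and> s < sum h F"
    using ex_finite_packing assms(5) s by (metis less_imp_le)
  then obtain F h where F: "\<And>i. i \<in> {1..m} \<Longrightarrow> finite (F i) \<and> F i \<subseteq> E i"
    and h: "\<And>i. i \<in> {1..m} \<Longrightarrow> packing (F i) id (h i)" "\<And>i. i \<in> {1..m} \<Longrightarrow> s < sum (h i) (F i)"
    by metis
  have F_ne: "F i \<noteq> {}" if "i \<in> {1..m}" for i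
    using h(2)[OF that] s by auto
  interpret rainbow_penalty "{1..m}" F c
    by unfold_locales (use F F_ne edge c in blast)+
  obtain e a where e: "e \<in> PiE {1..m} F" and a: "packing {1..m} e a"
    and size: "s \<le> (1 + c / 2) * sum a {1..m}"
    using ex_large_rainbow[of h s] h s assms(2) by (auto simp: less_imp_le)
  have e_in: "e j \<in> E j" if "j \<in> {1..m}" for j
    using e F that by (auto simp: PiE_def Pi_def)
  have e_ne: "e j \<noteq> {}" if "j \<in> {1..m}" for j
    using edge[OF that e_in[OF that]] by auto
  have "n - \<gamma> < sum a {1..m}"
  proof (rule ccontr)
    assume "\<not> ?thesis"
    then have le: "sum a {1..m} \<le> n - \<gamma>" by simp
    have "(1 + c / 2) * sum a {1..m} \<le> (1 + c / 2) * (n - \<gamma>)"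
      using le c by (intro mult_left_mono) auto
    also have "\<dots> = n - \<gamma> + c * n / 2 - c * \<gamma> / 2" by (simp add: field_simps)
    also have "\<dots> < n - \<gamma> / 2"
      using c(3) \<gamma>(1) mult_pos_pos[OF c(1) \<gamma>(1)] by linarith
    finally show False using size s by simp
  qed
  then obtain b where b: "packing {1..m} e b" "n \<le> sum b {1..m}"
    using \<gamma>(2)[OF e_ne a] by blast
  \<comment> \<open>Scaling down by a factor at most 1 keeps a packing and makes the size exactly
    \<open>n\<close>.\<close>
  define r where "r = n / sum b {1..m}"
  have r: "0 \<le> r" "r \<le> 1" "r * sum b {1..m} = n"
    using b(2) n by (auto simp: r_def)
  have "packing {1..m} e (\<lambda>j. r * b j)"
  proof -
    have "load {1..m} e (\<lambda>j. r * b j) v = r * load {1..m} e b v" for v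
      by (simp add: load_alt sum_distrib_left)
    moreover have "0 \<le> load {1..m} e b v" "load {1..m} e b v \<le> 1" for v
      using b(1) by (auto simp: packing_def intro!: load_nonneg)
    ultimately show ?thesis
      using r b(1) by (simp add: packing_def mult_le_one)
  qed
  moreover have "(\<Sum>j\<in>{1..m}. r * b j) = n"
    using r(3) by (simp add: sum_distrib_left)
  ultimately show ?thesis
    using rainbow_if_packing e_in by blast
qed

end
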